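(* Let $q=p^n$ where $p$ is an odd prime and $n\geq 1$, and let $m$ be a positive divisor of $q-1$. Set $r=(q-1)/m$, and set $\bar m=m$ if $r$ is even and $\bar m=m/2$ if $r$ is odd. Then the following hold. (1) If $\omega(\Gamma_{q,\bar m})=\chi(\Gamma_{q,\bar m})$, then $G_{q,m}$ is non-synchronizing. (2) If $m\in\{2,3\}$ (and $2m\mid q-1$, so that $\Gamma_{q,m}$ is defined), then $G_{q,m}$ is non-synchronizing if and only if $\omega(\Gamma_{q,m})=\chi(\Gamma_{q,m})$. (3) Suppose that $n$ is a prime and that $m\in\{2,3\}$. If $m\nmid p^{n-1}+p^{n-2}+\cdots+p+1$, then $G_{q,m}$ is synchronizing. (4) If $n$ is even and $\gcd(m,p^{n/2}+1)\neq 1$, then $G_{q,m}$ is non-synchronizing. (5) If $n$ is odd, then $G_{q,2}$ is synchronizing. (6) The group $G_{p^2,2}$ is always non-synchronizing, while $G_{p^2,3}$ (defined when $3\mid p^2-1$) is non-synchronizing if and only if $3\mid p+1$.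
   Context: For an odd prime-power $q$ and $m\mid q-1$, set $S_{q,m}=\{\alpha^m\mid\alpha\in\mathbb{F}_q^*\}$, the subgroup of $\mathbb{F}_q^*$ of order $(q-1)/m$. Let $T=\{\sigma_\alpha\mid\alpha\in\mathbb{F}_q\}$ with $\sigma_\alpha:\beta\mapsto\beta+\alpha$, and $Z_{q,m}=\{\mu_\alpha\mid\alpha\in S_{q,m}\}$ with $\mu_\alpha:\beta\mapsto\beta\alpha$; these are subgroups of the symmetric group on $\mathbb{F}_q$. Set $G_{q,m}=\langle T,Z_{q,m}\rangle=T\rtimes Z_{q,m}$, a permutation group acting on $\mathbb{F}_q$. For a natural number $m$ with $2m\mid q-1$ (so that $-1\in S_{q,m}$), the generalized Paley graph $\Gamma_{q,m}$ is the undirected simple graph with vertex set $\mathbb{F}_q$ and edge set $\{\{\alpha,\beta\}\mid\alpha-\beta\in S_{q,m}\}$. (With $\bar m$ as defined in the claim, $2\bar m\mid q-1$ always holds.) For a graph $\Gamma$, $\omega(\Gamma)$ is the clique number and $\chi(\Gamma)$ the chromatic number. Let $G$ be a permutation group on a finite set $\Omega$. A section for a partition $\mathscr P$ of $\Omega$ is a subset $S\subseteq\Omega$ containing precisely one element from each part of $\mathscr P$. The partition $\mathscr P$ is $G$-regular if it admits a section $S$ such that $Sg$ is a section for $\mathscr P$ for all $g\in G$. The trivial partitions are $\{\Omega\}$ and $\{\{\omega\}\mid\omega\in\Omega\}$. $G$ is synchronizing if $G\neq 1$ and there are no non-trivial $G$-regular partitions of $\Omega$; otherwise it is non-synchroni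zing.
   Formalization: In part (1) the case m̄ = 1 is excluded: there Γ_{q,1} is the complete graph, so ω = χ = q, yet G_{q,m} (m = 1, or m = 2 with r odd) is synchronizing, e.g. q = 3, m = 1, so (1) as printed fails. *)

theory Defs
  imports
    "HOL-Algebra.Bij"
    "HOL-Algebra.Generated_Groups"
    "HOL-Library.Disjoint_Sets"
    "HOL-Library.Ramsey"
    "HOL-Computational_Algebra.Primes"
begin

section \<open>Synchronizing permutation groups\<close>

text \<open>Permutations of \<open>\<Omega>\<close> are elements of \<open>Bij \<Omega>\<close>, the carrier of \<open>BijGroup \<Omega>\<close>.
  The definitions below are meant for \<open>G\<close> a subgroup of \<open>BijGroup \<Omega>\<close>, with \<open>\<Omega>\<close> finite.\<close>

definition is_section :: "'a set \<Rightarrow> 'a set set \<Rightarrow> 'a set \<Rightarrow> bool" where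
  "is_section \<Omega> P S \<longleftrightarrow> S \<subseteq> \<Omega> \<and> (\<forall>A\<in>P. \<exists>!x. x \<in> A \<inter> S)"

definition regular_partition :: "'a set \<Rightarrow> ('a \<Rightarrow> 'a) set \<Rightarrow> 'a set set \<Rightarrow> bool" where
  "regular_partition \<Omega> G P \<longleftrightarrow>
     partition_on \<Omega> P \<and> (\<exists>S. is_section \<Omega> P S \<and> (\<forall>g\<in>G. is_section \<Omega> P (g ` S)))"

definition trivial_partition :: "'a set \<Rightarrow> 'a set set \<Rightarrow> bool" where
  "trivial_partition \<Omega> P \<longleftrightarrow> P = {\<Omega>} \<or> P = {{\<omega>} |\<omega>. \<omega> \<in> \<Omega>}"

definition synchronizing :: "'a set \<Rightarrow> ('a \<Rightarrow> 'a) set \<Rightarrow> bool" where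
  "synchronizing \<Omega> G \<longleftrightarrow>
     G \<noteq> {\<one>\<^bsub>BijGroup \<Omega>\<^esub>} \<and> \<not> (\<exists>P. regular_partition \<Omega> G P \<and> \<not> trivial_partition \<Omega> P)"

abbreviation non_synchronizing :: "'a set \<Rightarrow> ('a \<Rightarrow> 'a) set \<Rightarrow> bool" where
  "non_synchronizing \<Omega> G \<equiv> \<not> synchronizing \<Omega> G"


section \<open>Clique number and chromatic number\<close>

text \<open>A finite simple graph is given by a vertex set \<open>V\<close> and a set \<open>E\<close> of two-element subsets
  of \<open>V\<close>.\<close>

definition clique_number :: "'a set \<Rightarrow> 'a set set \<Rightarrow> nat" where
  "clique_number V E = Max {card C |C. C \<subseteq> V \<and> clique C E}"

definition proper_colouring :: "'a set \<Rightarrow> 'a set set \<Rightarrow> nat \<Rightarrow> ('a \<Rightarrow> nat) \<Rightarrow> bool" where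
  "proper_colouring V E k c \<longleftrightarrow>
     c ` V \<subseteq> {..<k} \<and> (\<forall>u\<in>V. \<forall>v\<in>V. {u, v} \<in> E \<longrightarrow> c u \<noteq> c v)"

definition chromatic_number :: "'a set \<Rightarrow> 'a set set \<Rightarrow> nat" where
  "chromatic_number V E = (LEAST k. \<exists>c. proper_colouring V E k c)"


section \<open>The groups and the generalized Paley graphs\<close>

text \<open>The field is the type \<open>'a\<close>, so that \<open>q = card (UNIV :: 'a set)\<close> is not an argument.\<close>

definition power_subgroup :: "nat \<Rightarrow> 'a::{finite,field} set" where
  "power_subgroup m = {\<alpha> ^ m |\<alpha>. \<alpha> \<noteq> 0}"

definition translation_maps :: "('a::{finite,field} \<Rightarrow> 'a) set" where
  "translation_maps = {(\<lambda>\<beta>. \<beta> + \<alpha>) |\<alpha>. True}"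

definition multiplication_maps :: "nat \<Rightarrow> ('a::{finite,field} \<Rightarrow> 'a) set" where
  "multiplication_maps m = {(\<lambda>\<beta>. \<beta> * \<alpha>) |\<alpha>. \<alpha> \<in> power_subgroup m}"

definition affine_power_group :: "nat \<Rightarrow> ('a::{finite,field} \<Rightarrow> 'a) set" where
  "affine_power_group m = generate (BijGroup UNIV) (translation_maps \<union> multiplication_maps m)"

text \<open>This is an undirected graph as intended only if \<open>-1 \<in> power_subgroup m\<close>, i.e. (for odd
  \<open>q\<close>) if \<open>2 * m\<close> divides \<open>q - 1\<close>.  There are no loops, as \<open>0 \<notin> power_subgroup m\<close>.\<close>

definition paley_edges :: "nat \<Rightarrow> 'a::{finite,field} set set" where
  "paley_edges m = {{\<alpha>, \<beta>} |\<alpha> \<beta>. \<alpha> - \<beta> \<in> power_subgroup m}"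

end

theory Submission
  imports
    Defs
    "HOL-Library.Cardinality"
    "HOL-Library.Poly_Mapping"
    "HOL-Computational_Algebra.Polynomial"
    "HOL-Number_Theory.Residues"
begin

text \<open>Let \<open>F\<close> be the field of order \<open>q\<close>. Since the group contains all translations, a section \<open>S\<close>
  witnessing regularity and a part \<open>A\<close> satisfy \<open>F = A \<oplus> (- c S)\<close> for all \<open>m\<close>-th powers \<open>c\<close>. Such a factorisation survives multiplying
  one summand by an integer prime to \<open>p\<close>. If \<open>m\<close> is prime to \<open>N = (q - 1)/(p - 1)\<close>, every
  nonzero element of the field is an element of the prime field times an \<open>m\<close>-th power, so
  \<open>F = A \<oplus> (- c S)\<close> for all \<open>c \<noteq> 0\<close>; taking \<open>c\<close> to be a quotient of a difference in \<open>A\<close> and a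
  difference in \<open>S\<close> shows that one of \<open>A\<close>, \<open>S\<close> is a singleton. This gives the synchronizing cases.
  For \<open>m \<le> 3\<close> the same factorisation yields a clique together with a colouring of the same size.
  For even \<open>n\<close>, let \<open>K\<close> be the subfield of order \<open>\<surd>q\<close>. If \<open>d > 1\<close> divides \<open>m\<close> and \<open>\<surd>q + 1\<close>, then the
  nonzero elements of \<open>K\<close> are \<open>d\<close>-th powers, so the additive cosets of \<open>c K\<close> with \<open>c\<close> not a \<open>d\<close>-th
  power form a regular partition with section \<open>K\<close>.\<close>

section \<open>Factorisations of finite abelian groups\<close>

text \<open>The freshman's dream modulo \<open>k\<close>: the inner binomial coefficients of a prime
  are divisible by it, and induction goes from two summands to many. It is phrased as a divisibility
  because it is meant for an integral group ring, of characteristic 0.\<close>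

lemma prime_dvd_power_sum_diff:
  fixes f :: "'b \<Rightarrow> 'a::comm_ring_1"
  assumes "prime k"
  shows "of_nat k dvd (\<Sum>i\<in>A. f i) ^ k - (\<Sum>i\<in>A. f i ^ k)"
proof (induction A rule: infinite_finite_induct)
  case (insert a A)
  have two: "of_nat k dvd (x + y) ^ k - (x ^ k + y ^ k)" for x y :: 'a
  proof -
    have k: "k > 0" using assms by (rule prime_gt_0_nat)
    have "(x + y) ^ k = (\<Sum>j\<le>k. of_nat (k choose j) * x ^ j * y ^ (k - j))"
      by (rule binomial_ring)
    also have "\<dots> = (\<Sum>j\<in>{0,k}. of_nat (k choose j) * x ^ j * y ^ (k - j))
        + (\<Sum>j\<in>{..k} - {0,k}. of_nat (k choose j) * x ^ j * y ^ (k - j))"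
      by (subst add.commute) (rule sum.subset_diff, auto)
    finally have "(x + y) ^ k - (x ^ k + y ^ k)
        = (\<Sum>j\<in>{..k} - {0,k}. of_nat (k choose j) * x ^ j * y ^ (k - j))"
      using k by (simp add: algebra_simps)
    also have "of_nat k dvd \<dots>"
    proof (rule dvd_sum)
      fix j assume "j \<in> {..k} - {0,k}"
      then have "k dvd (k choose j)"
        by (intro dvd_choose_prime) (use assms in auto)
      then show "of_nat k dvd of_nat (k choose j) * x ^ j * y ^ (k - j)"
        by (elim dvdE) (simp add: mult.assoc)
    qed
    finally show ?thesis .
  qed
  have "of_nat k dvd ((f a + sum f A) ^ k - (f a ^ k + sum f A ^ k)) + (sum f A ^ k - (\<Sum>i\<in>A. f i ^ k))"
    by (intro dvd_add two insert.IH)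
  then show ?case
    using insert.hyps by (simp add: algebra_simps)
qed (use assms in \<open>auto simp: power_0_left\<close>)

text \<open>The sets are arbitrary subsets, not subgroups: this is a factorisation, or tiling, of
  the additive group.\<close>

definition direct_sum :: "'a::ab_group_add set \<Rightarrow> 'a set \<Rightarrow> bool" where
  "direct_sum A B \<longleftrightarrow> bij_betw (\<lambda>(a, b). a + b) (A \<times> B) UNIV"

lemma direct_sumI:
  assumes "\<And>x. \<exists>a\<in>A. \<exists>b\<in>B. x = a + b"
    and "\<And>a a' b b'. a \<in> A \<Longrightarrow> a' \<in> A \<Longrightarrow> b \<in> B \<Longrightarrow> b' \<in> B \<Longrightarrow> a + b = a' + b' \<Longrightarrow> a = a'"
  shows "direct_sum A B"
  unfolding direct_sum_def
proof (rule bij_betw_imageI)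
  show "inj_on (\<lambda>(a, b). a + b) (A \<times> B)"
  proof (rule inj_onI, clarify)
    fix a b a' b'
    assume mem: "a \<in> A" "b \<in> B" "a' \<in> A" "b' \<in> B" and eq: "a + b = a' + b'"
    have "a = a'"
      using mem(1,3,2,4) eq by (rule assms(2))
    then show "a = a' \<and> b = b'"
      using eq by simp
  qed
  show "(\<lambda>(a, b). a + b) ` (A \<times> B) = UNIV"
  proof (intro equalityI subset_UNIV subsetI)
    fix x
    obtain a b where "a \<in> A" "b \<in> B" "x = a + b"
      using assms(1)[of x] by blast
    then show "x \<in> (\<lambda>(a, b). a + b) ` (A \<times> B)"
      by (intro image_eqI[of _ _ "(a, b)"]) auto
  qed
qed

lemma direct_sum_unique:
  assumes "direct_sum A B" "a \<in> A" "a' \<in> A" "b \<in> B" "b' \<in> B" "a + b = a' + b'"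
  shows "a = a' \<and> b = b'"
  using assms unfolding direct_sum_def bij_betw_def inj_on_def by auto

lemma direct_sum_obtain:
  assumes "direct_sum A B"
  obtains a b where "a \<in> A" "b \<in> B" "x = a + b"
proof -
  have "x \<in> (\<lambda>(a, b). a + b) ` (A \<times> B)"
    using assms unfolding direct_sum_def bij_betw_def by auto
  then show ?thesis
    using that by auto
qed

lemma direct_sum_commute:
  assumes "direct_sum A B"
  shows "direct_sum B A"
proof -
  have "bij_betw prod.swap (B \<times> A) (A \<times> B)"
    by (rule bij_betwI[of _ _ _ prod.swap]) auto
  from bij_betw_trans[OF this assms[unfolded direct_sum_def]] show ?thesis
    unfolding direct_sum_def by (simp add: o_def case_prod_unfold add.commute)
qed

lemma direct_sum_card:
  fixes A :: "'a::{finite,ab_group_add} set"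
  shows "direct_sum A B \<Longrightarrow> card A * card B = CARD('a)"
  unfolding direct_sum_def by (metis bij_betw_same_card card_cartesian_product)

text \<open>A surjection from a finite set onto one at least as large is injective. The group ring
  argument only shows that every element is represented; uniqueness comes from here.\<close>

lemma direct_sumI_card:
  fixes A :: "'a::{finite,ab_group_add} set"
  assumes "\<And>x. \<exists>a\<in>A. \<exists>b\<in>B. x = a + b" and "card A * card B \<le> CARD('a)"
  shows "direct_sum A B"
proof -
  let ?f = "\<lambda>(a, b). a + b"
  have im: "?f ` (A \<times> B) = UNIV"
    using assms(1) by (fastforce simp: image_iff)
  moreover have "card (?f ` (A \<times> B)) \<le> card (A \<times> B)"
    by (rule card_image_le) simp
  ultimately have "card (?f ` (A \<times> B)) = card (A \<times> B)"
    using assms(2) by (simp add: card_cartesian_product)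
  then show ?thesis
    unfolding direct_sum_def bij_betw_def using im by (auto intro: eq_card_imp_inj_on)
qed

text \<open>The argument takes place in the group ring over the integers: writing \<open>X S\<close> for the sum of
  the elements of \<open>S\<close>, one has \<open>X A ^ k \<equiv> X (k A)\<close> modulo \<open>k\<close>, while
  \<open>X A ^ k * X B = X A ^ (k - 1) * X UNIV\<close> has all its coefficients equal to \<open>card A ^ (k - 1)\<close>,
  which is prime to \<open>k\<close>.\<close>
lemma direct_sum_prime_multiple:
  fixes A B :: "'a::{finite,comm_ring_1} set"
  assumes AB: "direct_sum A B" and k: "prime k" and coprime: "\<not> k dvd CARD('a)"
  shows "direct_sum ((*) (of_nat k) ` A) B"
proof (rule direct_sumI_card)
  have "card ((*) (of_nat k) ` A) \<le> card A"
    by (rule card_image_le) simp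
  then show "card ((*) (of_nat k) ` A) * card B \<le> CARD('a)"
    using direct_sum_card[OF AB] by (metis mult_le_mono1)
next
  fix x :: 'a
  define X where "X S = (\<Sum>s\<in>S. Poly_Mapping.single s (1::int))" for S :: "'a set"
  have lookup_X: "Poly_Mapping.lookup (X UNIV) x = 1"
    unfolding X_def by (simp add: lookup_sum lookup_single when_def)
  have "X A * X B = (\<Sum>(a, b)\<in>A \<times> B. Poly_Mapping.single (a + b) 1)"
    unfolding X_def by (simp add: sum_product mult_single sum.cartesian_product)
  also have "\<dots> = X UNIV"
    unfolding X_def using sum.reindex_bij_betw[OF AB[unfolded direct_sum_def], of "\<lambda>s. Poly_Mapping.single s (1::int)"]
    by (simp add: case_prod_unfold)
  finally have XAB: "X A * X B = X UNIV" .
  have single_UNIV: "Poly_Mapping.single a 1 * X UNIV = X UNIV" for a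
  proof -
    have "Poly_Mapping.single a 1 * X UNIV = (\<Sum>s\<in>UNIV. Poly_Mapping.single (a + s) 1)"
      unfolding X_def by (simp add: sum_distrib_left mult_single)
    also have "\<dots> = X UNIV"
      unfolding X_def by (rule sum.reindex_bij_witness[of _ "\<lambda>s. s - a" "\<lambda>s. a + s"]) auto
    finally show ?thesis .
  qed
  have mult_UNIV: "X A * X UNIV = of_nat (card A) * X UNIV"
    unfolding X_def[of A] by (simp add: sum_distrib_right single_UNIV)
  have power_UNIV: "X A ^ j * X UNIV = of_nat (card A ^ j) * X UNIV" for j
  proof (induction j)
    case (Suc j)
    have "X A ^ Suc j * X UNIV = X A * (X A ^ j * X UNIV)"
      by (simp add: mult.assoc)
    also have "\<dots> = of_nat (card A ^ j) * (X A * X UNIV)"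
      unfolding Suc.IH by (rule mult.left_commute)
    finally show ?case
      unfolding mult_UNIV by (simp add: mult_ac)
  qed simp
  have single_power: "Poly_Mapping.single a (1::int) ^ j = Poly_Mapping.single (of_nat j * a) 1" for a :: 'a and j
    by (induction j) (simp_all add: mult_single algebra_simps)
  have "X A ^ k * X B = X A ^ (k - 1) * (X A * X B)"
    using prime_gt_0_nat[OF k] by (metis Suc_diff_1 mult.assoc power_Suc2)
  then have eq: "X A ^ k * X B = of_nat (card A ^ (k - 1)) * X UNIV"
    by (simp add: XAB power_UNIV)
  have "of_nat k dvd (X A ^ k - (\<Sum>a\<in>A. Poly_Mapping.single a (1::int) ^ k)) * X B"
    unfolding X_def[of A] by (intro dvd_mult2 prime_dvd_power_sum_diff k)
  also have "(X A ^ k - (\<Sum>a\<in>A. Poly_Mapping.single a (1::int) ^ k)) * X B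
      = of_nat (card A ^ (k - 1)) * X UNIV
        - (\<Sum>(a, b)\<in>A \<times> B. Poly_Mapping.single (of_nat k * a + b) 1)"
    unfolding left_diff_distrib eq
    by (simp add: X_def[of B] single_power sum_product mult_single sum.cartesian_product)
  finally obtain Y where Y: "of_nat (card A ^ (k - 1)) * X UNIV
        - (\<Sum>(a, b)\<in>A \<times> B. Poly_Mapping.single (of_nat k * a + b) 1) = of_nat k * Y"
    by (auto simp: dvd_def)
  have lookup_of_nat_mult: "Poly_Mapping.lookup (of_nat c * Z) x = int c * Poly_Mapping.lookup Z x"
    for c and Z :: "'a \<Rightarrow>\<^sub>0 int"
    by (induction c) (simp_all add: lookup_add algebra_simps)
  show "\<exists>a\<in>(*) (of_nat k) ` A. \<exists>b\<in>B. x = a + b"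
  \<comment> \<open>A missed \<open>x\<close> has coefficient 0 in the sum over
    \<open>A \<times> B\<close>; comparing coefficients at \<open>x\<close> then makes
    \<open>k\<close> divide \<open>card A ^ (k - 1)\<close>, hence \<open>card A\<close>, hence the
    order of the group.\<close>
  proof (rule ccontr)
    assume "\<not> ?thesis"
    then have "Poly_Mapping.lookup (\<Sum>(a, b)\<in>A \<times> B. Poly_Mapping.single (of_nat k * a + b) (1::int)) x = 0"
      unfolding lookup_sum by (intro sum.neutral) (force simp: lookup_single when_def)
    then have "int (card A ^ (k - 1)) = int k * Poly_Mapping.lookup Y x"
      using arg_cong[OF Y, of "\<lambda>Z. Poly_Mapping.lookup Z x"]
      by (simp only: lookup_minus lookup_of_nat_mult lookup_X)
    then have "int k dvd int (card A ^ (k - 1))"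
      by simp
    then have "k dvd card A"
      using k int_dvd_int_iff prime_dvd_power_nat by blast
    then show False
      using coprime direct_sum_card[OF AB] by (metis dvd_mult2)
  qed
qed

lemma direct_sum_multiple:
  fixes A B :: "'a::{finite,comm_ring_1} set"
  assumes "direct_sum A B" "coprime k (CARD('a))" "k > 0"
  shows "direct_sum ((*) (of_nat k) ` A) B"
  using assms(2,3)
proof (induction k rule: prime_divisors_induct)
  case zero
  then show ?case by simp
next
  case (unit k)
  then show ?case using assms(1) by simp
next
  case (factor k j)
  have "coprime k (CARD('a))" "coprime j (CARD('a))" "j > 0"
    using factor.prems by auto
  then have "\<not> k dvd CARD('a)"
    using \<open>prime k\<close> by (metis coprime_absorb_left not_prime_unit)
  have "direct_sum ((*) (of_nat j) ` A) B"
    by (rule factor.IH) fact+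
  then have "direct_sum ((*) (of_nat k) ` (*) (of_nat j) ` A) B"
    by (rule direct_sum_prime_multiple) fact+
  then show ?case
    by (simp add: image_image mult.assoc)
qed

section \<open>Power subgroups of finite fields\<close>

lemma card_roots_of_unity_le:
  fixes k :: nat
  assumes "k > 0"
  shows "card {x::'a::idom. x ^ k = 1} \<le> k"
proof -
  let ?p = "Polynomial.monom (1::'a) k - 1"
  have "Polynomial.coeff ?p k \<noteq> 0"
    using assms by simp
  then have "?p \<noteq> 0"
    by (metis coeff_0)
  then have "card {x. poly ?p x = 0} \<le> degree ?p"
    by (rule card_poly_roots_bound)
  also have "\<dots> \<le> k"
    by (intro degree_diff_le degree_monom_le) simp
  finally show ?thesis
    by (simp add: poly_monom)
qed

text \<open>Multiplication by \<open>x\<close> permutes the nonzero elements, so their product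
  equals itself times \<open>x ^ (q - 1)\<close>, with \<open>q\<close> the order of the
  field.\<close>

lemma field_power_card_minus_1:
  fixes x :: "'a::{finite,field}"
  assumes "x \<noteq> 0"
  shows "x ^ (CARD('a) - 1) = 1"
proof -
  have "x ^ (CARD('a) - 1) * \<Prod>(UNIV - {0}) = (\<Prod>y\<in>UNIV - {0}. x * y)"
    by (simp add: prod.distrib)
  also have "\<dots> = \<Prod>(UNIV - {0})"
    by (rule prod.reindex_bij_witness[of _ "\<lambda>y. y / x" "\<lambda>y. x * y"]) (use assms in auto)
  finally show ?thesis
    by simp
qed

lemma CARD_field_gt_1: "CARD('a::{finite,field}) > 1"
  using card_mono[of UNIV "{0::'a, 1}"] by simp

text \<open>Counting replaces the cyclicity of the multiplicative group. Each fibre of the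
  \<open>m\<close>-th power map has at most \<open>m\<close> elements, so there are at least
  \<open>(q - 1) div m\<close> values; all of them are roots of
  \<open>x ^ ((q - 1) div m) = 1\<close>, which has at most that many.\<close>

lemma power_subgroup_eq_roots:
  assumes "m dvd CARD('a::{finite,field}) - 1"
  shows "(power_subgroup m :: 'a set) = {x. x ^ ((CARD('a) - 1) div m) = 1}"
    and "card (power_subgroup m :: 'a set) = (CARD('a) - 1) div m"
proof -
  let ?S = "power_subgroup m :: 'a set" and ?N = "(CARD('a) - 1) div m"
  let ?R = "{x::'a. x ^ ?N = 1}"
  have N: "m * ?N = CARD('a) - 1"
    using assms by simp
  have "m > 0" "?N > 0"
    using N CARD_field_gt_1[where ?'a = 'a] by (auto intro!: gr0I)
  have sub: "?S \<subseteq> ?R"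
    by (auto simp: power_subgroup_def N field_power_card_minus_1 simp flip: power_mult simp del: One_nat_def)
  have fibre: "card {x. x ^ m = y} \<le> m" if "y \<in> ?S" for y
  proof -
    obtain z where z: "y = z ^ m" "z \<noteq> 0"
      using \<open>y \<in> ?S\<close> unfolding power_subgroup_def by blast
    have "card {x. x ^ m = y} \<le> card {x::'a. x ^ m = 1}"
      by (rule card_inj_on_le[of "\<lambda>x. x / z"]) (use z in \<open>auto simp: inj_on_def power_divide\<close>)
    also have "\<dots> \<le> m"
      using \<open>m > 0\<close> by (rule card_roots_of_unity_le)
    finally show ?thesis .
  qed
  have "m * ?N = card (UNIV - {0::'a})"
    unfolding N by (simp add: card_Diff_singleton)
  also have "\<dots> \<le> card (\<Union>y\<in>?S. {x. x ^ m = y})"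
    by (rule card_mono) (auto simp: power_subgroup_def)
  also have "\<dots> \<le> (\<Sum>y\<in>?S. card {x. x ^ m = y})"
    by (rule card_UN_le) simp
  also have "\<dots> \<le> of_nat (card ?S) * m"
    by (rule sum_bounded_above) (rule fibre)
  finally have "?N \<le> card ?S"
    using \<open>m > 0\<close> by (simp add: mult.commute)
  moreover have "card ?S \<le> card ?R"
    by (rule card_mono) (use sub in auto)
  moreover have "card ?R \<le> ?N"
    using \<open>?N > 0\<close> by (rule card_roots_of_unity_le)
  ultimately show "?S = ?R" "card ?S = ?N"
    using card_subset_eq[OF _ sub] by auto
qed

lemma power_subgroup_nonzero: "x \<in> power_subgroup m \<Longrightarrow> x \<noteq> 0"
  by (auto simp: power_subgroup_def)

lemma power_subgroup_one: "1 \<in> power_subgroup m"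
  by (auto simp: power_subgroup_def intro: exI[of _ 1])

lemma power_subgroup_mult:
  assumes "x \<in> power_subgroup m" "y \<in> power_subgroup m"
  shows "x * y \<in> power_subgroup m"
proof -
  obtain u v where "u \<noteq> 0" "v \<noteq> 0" "x = u ^ m" "y = v ^ m"
    using assms by (auto simp: power_subgroup_def)
  then show ?thesis
    unfolding power_subgroup_def by (intro CollectI exI[of _ "u * v"]) (simp add: power_mult_distrib)
qed

lemma power_subgroup_inverse:
  assumes "x \<in> power_subgroup m"
  shows "inverse x \<in> power_subgroup m"
proof -
  obtain u where "u \<noteq> 0" "x = u ^ m"
    using assms by (auto simp: power_subgroup_def)
  then show ?thesis
    unfolding power_subgroup_def by (intro CollectI exI[of _ "inverse u"]) (simp add: power_inverse)
qed

lemma power_subgroup_mono: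
  assumes "k dvd m"
  shows "(power_subgroup m :: 'a::{finite,field} set) \<subseteq> power_subgroup k"
proof
  fix x :: 'a assume "x \<in> power_subgroup m"
  then obtain u where "u \<noteq> 0" "x = u ^ m"
    by (auto simp: power_subgroup_def)
  moreover obtain j where "m = k * j"
    using assms by blast
  ultimately show "x \<in> power_subgroup k"
    unfolding power_subgroup_def
    by (intro CollectI exI[of _ "u ^ j"]) (simp add: mult.commute flip: power_mult)
qed

text \<open>In the description by roots the exponent \<open>(q - 1) div m\<close> is even, so signs
  do not matter.\<close>

lemma uminus_mem_power_subgroup:
  assumes "2 * m dvd CARD('a::{finite,field}) - 1" and "(x::'a) \<in> power_subgroup m"
  shows "- x \<in> power_subgroup m"
proof -
  obtain j where j: "CARD('a) - 1 = 2 * m * j"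
    using assms(1) by blast
  then have m: "m dvd CARD('a) - 1" "m > 0"
    using CARD_field_gt_1[where ?'a = 'a] by (auto intro!: gr0I)
  have "(CARD('a) - 1) div m = 2 * j"
    unfolding j using m(2) by simp
  then show ?thesis
    using assms(2) by (simp add: power_subgroup_eq_roots(1)[OF m(1)] power_mult)
qed

lemma obtain_not_power:
  assumes "m dvd CARD('a::{finite,field}) - 1" and "m \<noteq> 1"
  obtains c :: "'a::{finite,field}" where "c \<noteq> 0" "c \<notin> power_subgroup m"
proof -
  obtain j where j: "CARD('a) - 1 = m * j"
    using assms(1) by blast
  then have "m > 0" "j > 0"
    using CARD_field_gt_1[where ?'a = 'a] by (auto intro!: gr0I)
  then have "m > 1"
    using assms(2) by linarith
  then have "card (power_subgroup m :: 'a set) < CARD('a) - 1"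
    unfolding power_subgroup_eq_roots(2)[OF assms(1)] j using \<open>j > 0\<close> by simp
  moreover have "card (insert (0::'a) (power_subgroup m)) \<le> Suc (card (power_subgroup m :: 'a set))"
    by (rule card_insert_le_m1) simp_all
  ultimately have "card (insert (0::'a) (power_subgroup m)) < CARD('a)"
    by linarith
  then have "insert (0::'a) (power_subgroup m) \<noteq> UNIV"
    by fastforce
  then show ?thesis
    using that by auto
qed

section \<open>Characteristic and prime field\<close>

lemma CHAR_eq_of_CARD_prime_power:
  assumes "prime p" "CARD('a::{finite,field}) = p ^ n"
  shows "CHAR('a) = p"
proof -
  have "CHAR('a) > 0"
    by (intro finite_imp_CHAR_pos) simp
  then have "prime (CHAR('a))"
    by (rule prime_CHAR_semidom)
  moreover have "CHAR('a) dvd p ^ n"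
    using CHAR_dvd_CARD[where ?'a = 'a] assms(2) by simp
  ultimately show ?thesis
    using assms(1) prime_dvd_power primes_dvd_imp_eq by blast
qed

text \<open>Fermat's little theorem makes the \<open>p - 1\<close> nonzero residues roots, and there
  are no more. Membership in the prime field can thus be tested by a power.\<close>

lemma prime_field_eq_roots_of_unity:
  assumes "prime p" "CHAR('a::{finite,field}) = p"
  shows "{y::'a. y ^ (p - 1) = 1} = of_nat ` {1..<p}"
proof -
  have p: "p - 1 > 0"
    using prime_gt_1_nat[OF assms(1)] by simp
  have sub: "of_nat ` {1..<p} \<subseteq> {y::'a. y ^ (p - 1) = 1}"
  proof clarify
    fix j assume "j \<in> {1..<p}"
    then have "[j ^ (p - 1) = 1] (mod p)"
      using assms(1) by (intro fermat_theorem) (auto dest: dvd_imp_le)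
    then have "of_nat (j ^ (p - 1)) = (of_nat 1 :: 'a)"
      by (subst of_nat_eq_iff_cong_CHAR) (simp add: assms(2))
    then show "of_nat j ^ (p - 1) = (1::'a)"
      by simp
  qed
  have "inj_on (of_nat :: nat \<Rightarrow> 'a) {1..<p}"
    by (auto simp: inj_on_def of_nat_eq_iff_cong_CHAR assms(2) cong_def)
  then have "card (of_nat ` {1..<p} :: 'a set) = p - 1"
    by (simp add: card_image)
  then show ?thesis
    using card_subset_eq[OF _ sub] card_roots_of_unity_le[OF p, where ?'a = 'a] card_mono[OF _ sub]
    by simp
qed

lemma sum_powers_times:
  fixes p :: nat
  assumes "p > 0"
  shows "(\<Sum>i<n. p ^ i) * (p - 1) = p ^ n - 1"
proof -
  obtain t where p: "p = Suc t"
    using assms gr0_implies_Suc by blast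
  have "(\<Sum>i<n. p ^ i) * t + 1 = p ^ n"
    by (induction n) (simp_all add: p algebra_simps)
  then show ?thesis
    by (simp add: p flip: diff_Suc_1)
qed

text \<open>With \<open>N = (q - 1) div (p - 1)\<close> and \<open>N * u = m * v + 1\<close>, the factorisation is
  \<open>x = x ^ (N * u) * (inverse x ^ v) ^ m\<close>; here \<open>x ^ N\<close> lies in the prime field.\<close>
lemma prime_field_times_power:
  fixes x :: "'a::{finite,field}"
  assumes p: "prime p" and card: "CARD('a) = p ^ n" and m: "coprime m (\<Sum>i<n. p ^ i)" and x: "x \<noteq> 0"
  obtains k d where "0 < k" "k < p" "d \<in> power_subgroup m" "x = of_nat k * d"
proof -
  define N where "N = (\<Sum>i<n. p ^ i)"
  have N: "N * (p - 1) = CARD('a) - 1"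
    unfolding N_def card using p by (intro sum_powers_times prime_gt_0_nat)
  then have "N \<noteq> 0"
    using CARD_field_gt_1[where ?'a = 'a] by (auto intro!: gr0I)
  then obtain u v where uv: "N * u = m * v + 1"
    using bezout_nat[of N m] m by (auto simp: N_def gcd.commute)
  have "(x ^ (N * u)) ^ (p - 1) = (x ^ (N * (p - 1))) ^ u"
    by (simp add: mult_ac flip: power_mult)
  also have "\<dots> = 1"
    unfolding N using x by (simp add: field_power_card_minus_1 del: One_nat_def)
  finally obtain k where k: "k \<in> {1..<p}" "x ^ (N * u) = of_nat k"
    using prime_field_eq_roots_of_unity[OF p CHAR_eq_of_CARD_prime_power[OF p card]] by blast
  have "x = x ^ (N * u) * (inverse x ^ v) ^ m"
    unfolding uv using x by (simp add: power_inverse mult.commute[of m] flip: power_mult)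
  then have "x = of_nat k * (inverse x ^ v) ^ m"
    by (simp only: k(2))
  moreover have "(inverse x ^ v) ^ m \<in> power_subgroup m"
    using x by (auto simp: power_subgroup_def)
  ultimately show ?thesis
    using k(1) by (intro that[of k "(inverse x ^ v) ^ m"]) simp_all
qed

section \<open>Regular partitions and factorisations\<close>

lemma affine_map_in_Bij:
  fixes c x :: "'a::{finite,field}"
  assumes "c \<noteq> 0"
  shows "(\<lambda>\<beta>. \<beta> * c + x) \<in> Bij UNIV"
proof -
  have "bij (\<lambda>\<beta>. \<beta> * c + x)"
    by (rule bij_betw_byWitness[of _ "\<lambda>\<beta>. (\<beta> - x) / c"]) (use assms in auto)
  then show ?thesis
    by (simp add: Bij_def)
qed

lemma mult_BijGroup_UNIV:
  "f \<in> Bij UNIV \<Longrightarrow> g \<in> Bij UNIV \<Longrightarrow> f \<otimes>\<^bsub>BijGroup UNIV\<^esub> g = (\<lambda>x. f (g x))"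
  by (simp add: BijGroup_def compose_def fun_eq_iff)

lemma one_BijGroup_UNIV: "\<one>\<^bsub>BijGroup UNIV\<^esub> = (\<lambda>x. x)"
  by (simp add: BijGroup_def fun_eq_iff)

lemma carrier_BijGroup: "carrier (BijGroup A) = Bij A"
  by (simp add: BijGroup_def)

lemma inv_affine_map:
  fixes c x :: "'a::{finite,field}"
  assumes "c \<noteq> 0"
  shows "inv\<^bsub>BijGroup UNIV\<^esub> (\<lambda>\<beta>. \<beta> * c + x) = (\<lambda>\<beta>. \<beta> * inverse c + - x / c)"
proof -
  have "(\<lambda>\<beta>. \<beta> * c + x) \<in> Bij UNIV" "(\<lambda>\<beta>. \<beta> * inverse c + - x / c) \<in> Bij UNIV"
    using assms by (intro affine_map_in_Bij; simp)+
  then show ?thesis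
    using assms
    by (intro group.inv_equality[OF group_BijGroup])
       (auto simp only: carrier_BijGroup mult_BijGroup_UNIV one_BijGroup_UNIV, simp add: field_simps)
qed

text \<open>This is the semidirect product made explicit: the affine maps shown contain the
  generators and are closed under composition and inverses, and each is a multiplication followed by
  a translation.\<close>

lemma affine_power_group_eq:
  "(affine_power_group m :: ('a::{finite,field} \<Rightarrow> 'a) set)
     = {(\<lambda>\<beta>. \<beta> * c + x) |c x. c \<in> power_subgroup m}" (is "_ = ?R")
proof (intro equalityI subsetI)
  have gens: "translation_maps \<union> multiplication_maps m \<subseteq> ?R"
    unfolding translation_maps_def multiplication_maps_def
    by (force intro: power_subgroup_one)
  fix f :: "'a \<Rightarrow> 'a" assume "f \<in> affine_power_group m"
  then show "f \<in> ?R"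
    unfolding affine_power_group_def
  proof (induction rule: generate.induct)
    case one
    show ?case
      by (intro CollectI exI[of _ 1] exI[of _ 0]) (simp add: one_BijGroup_UNIV power_subgroup_one)
  next
    case (incl h)
    then show ?case using gens by blast
  next
    case (inv h)
    then obtain c x where h: "h = (\<lambda>\<beta>. \<beta> * c + x)" and c: "c \<in> power_subgroup m"
      using gens by blast
    have "inv\<^bsub>BijGroup UNIV\<^esub> h = (\<lambda>\<beta>. \<beta> * inverse c + - x / c)"
      unfolding h using c by (intro inv_affine_map power_subgroup_nonzero)
    then show ?case
      using power_subgroup_inverse[OF c] by blast
  next
    case (eng h1 h2)
    then obtain c x d y where h: "h1 = (\<lambda>\<beta>. \<beta> * c + x)" "h2 = (\<lambda>\<beta>. \<beta> * d + y)"
      and cd: "c \<in> power_subgroup m" "d \<in> power_subgroup m"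
      by blast
    have "h1 \<in> Bij UNIV" "h2 \<in> Bij UNIV"
      unfolding h using cd affine_map_in_Bij power_subgroup_nonzero by blast+
    then have "h1 \<otimes>\<^bsub>BijGroup UNIV\<^esub> h2 = (\<lambda>\<beta>. \<beta> * (d * c) + (y * c + x))"
      by (simp add: mult_BijGroup_UNIV, simp add: h algebra_simps)
    then show ?case
      using power_subgroup_mult[OF cd(2,1)] by blast
  qed
next
  fix f :: "'a \<Rightarrow> 'a" assume "f \<in> ?R"
  then obtain c x where f: "f = (\<lambda>\<beta>. \<beta> * c + x)" and c: "c \<in> power_subgroup m"
    by blast
  let ?t = "\<lambda>\<beta>. \<beta> + x" and ?s = "\<lambda>\<beta>. \<beta> * c"
  have "?t \<in> translation_maps" "?s \<in> multiplication_maps m"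
    using c by (auto simp: translation_maps_def multiplication_maps_def)
  then have "?t \<otimes>\<^bsub>BijGroup UNIV\<^esub> ?s \<in> affine_power_group m"
    unfolding affine_power_group_def by (intro generate.eng generate.incl) auto
  moreover have "?t \<in> Bij UNIV" "?s \<in> Bij UNIV"
    using affine_map_in_Bij[of 1 x] affine_map_in_Bij[of c 0] power_subgroup_nonzero[OF c] by simp_all
  ultimately show "f \<in> affine_power_group m"
    by (simp add: mult_BijGroup_UNIV f)
qed

section \<open>From regular partitions to factorisations of the field\<close>

text \<open>If \<open>S\<close> had only one point, every part would contain it and there would be
  one part; if every part had only one point, the partition would be discrete. The two pairs later
  supply nonzero differences.\<close>

lemma nontrivial_regular_partition:
  assumes P: "partition_on \<Omega> P" and S: "is_section \<Omega> P S" and nontriv: "\<not> trivial_partition \<Omega> P"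
    and "\<Omega> \<noteq> {}"
  obtains A a a' s s' where "A \<in> P" "a \<in> A" "a' \<in> A" "a \<noteq> a'" "s \<in> S" "s' \<in> S" "s \<noteq> s'"
proof -
  have U: "\<Union>P = \<Omega>" and "{} \<notin> P"
    using P by (simp_all add: partition_on_def)
  have "\<exists>s\<in>S. \<exists>s'\<in>S. s \<noteq> s'"
  proof (rule ccontr)
    assume single: "\<not> ?thesis"
    have eq: "A = B" if AB: "A \<in> P" "B \<in> P" for A B
    proof -
      obtain x where x: "x \<in> A" "x \<in> S"
        using S AB(1) unfolding is_section_def by blast
      obtain y where y: "y \<in> B" "y \<in> S"
        using S AB(2) unfolding is_section_def by blast
      have "x = y"
        using single x(2) y(2) by blast
      then show ?thesis
        using AB x y disjointD[OF partition_onD2[OF P] AB] by blast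
    qed
    obtain A where A: "A \<in> P"
      using \<open>\<Omega> \<noteq> {}\<close> U by blast
    have "P = {A}"
      using eq[OF A] A by blast
    then show False
      using nontriv U unfolding trivial_partition_def by simp
  qed
  moreover have "\<exists>A\<in>P. \<exists>a\<in>A. \<exists>a'\<in>A. a \<noteq> a'"
  proof (rule ccontr)
    assume single: "\<not> ?thesis"
    have sing: "A = {a}" if "A \<in> P" "a \<in> A" for A a
      using single that by blast
    have "P = (\<lambda>\<omega>. {\<omega>}) ` \<Omega>"
    proof (intro equalityI subsetI)
      fix A assume A: "A \<in> P"
      then obtain a where a: "a \<in> A"
        using \<open>{} \<notin> P\<close> by (cases "A = {}") auto
      have "a \<in> \<Omega>"
        using a A U by blast
      then show "A \<in> (\<lambda>\<omega>. {\<omega>}) ` \<Omega>"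
        unfolding sing[OF A a] by (rule imageI)
    next
      fix A assume "A \<in> (\<lambda>\<omega>. {\<omega>}) ` \<Omega>"
      then obtain a B where "A = {a}" "a \<in> B" "B \<in> P"
        using U by blast
      then show "A \<in> P"
        using sing by metis
    qed
    then show False
      using nontriv unfolding trivial_partition_def by (simp add: Setcompr_eq_image)
  qed
  ultimately show ?thesis
    using that by blast
qed

text \<open>A point of \<open>A\<close> in the image of \<open>S\<close> under
  \<open>\<beta> * c + x\<close> satisfies \<open>a = s * c + x\<close>, that is,
  \<open>x = a + - (s * c)\<close>. One such point for every \<open>x\<close> means one
  representation of every \<open>x\<close>.\<close>

lemma regular_partition_direct_sum:
  fixes S :: "'a::{finite,field} set"
  assumes S: "\<forall>g\<in>affine_power_group m. is_section UNIV P (g ` S)" and A: "A \<in> P"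
    and c: "c \<in> power_subgroup m"
  shows "direct_sum A ((\<lambda>s. - (s * c)) ` S)"
proof -
  have sec: "\<exists>!y. y \<in> A \<inter> (\<lambda>\<beta>. \<beta> * c + x) ` S" for x
  proof -
    have "(\<lambda>\<beta>. \<beta> * c + x) \<in> affine_power_group m"
      unfolding affine_power_group_eq using c by blast
    then have "is_section UNIV P ((\<lambda>\<beta>. \<beta> * c + x) ` S)"
      using S by (rule bspec[rotated])
    then show ?thesis
      using A unfolding is_section_def by (elim conjE bspec)
  qed
  show ?thesis
  proof (rule direct_sumI)
    fix x
    obtain y where "y \<in> A" "y \<in> (\<lambda>\<beta>. \<beta> * c + x) ` S"
      using sec[of x] by blast
    then obtain s where "y \<in> A" "s \<in> S" "y = s * c + x"
      by (elim imageE)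
    then show "\<exists>a\<in>A. \<exists>b\<in>(\<lambda>s. - (s * c)) ` S. x = a + b"
      by (intro bexI[of _ y] bexI[of _ "- (s * c)"] image_eqI[of _ _ s]) simp_all
  next
    fix a a' b b'
    assume "a \<in> A" "a' \<in> A" "b \<in> (\<lambda>s. - (s * c)) ` S" "b' \<in> (\<lambda>s. - (s * c)) ` S" "a + b = a' + b'"
    then obtain s s' where mem: "a \<in> A" "a' \<in> A" "s \<in> S" "s' \<in> S"
      and b: "b = - (s * c)" "b' = - (s' * c)" and eq: "a + b = a' + b'"
      by (elim imageE)
    have "a = s * c + (a + b)"
      unfolding b(1) by simp
    then have "a \<in> (\<lambda>\<beta>. \<beta> * c + (a + b)) ` S"
      using mem(3) by (rule image_eqI)
    moreover have "a' = s' * c + (a + b)"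
      unfolding eq b(2) by simp
    then have "a' \<in> (\<lambda>\<beta>. \<beta> * c + (a + b)) ` S"
      using mem(4) by (rule image_eqI)
    ultimately have both: "a \<in> A \<inter> (\<lambda>\<beta>. \<beta> * c + (a + b)) ` S" "a' \<in> A \<inter> (\<lambda>\<beta>. \<beta> * c + (a + b)) ` S"
      using mem(1,2) by (simp_all only: Int_iff)
    show "a = a'"
    proof (rule ex1E[OF sec[of "a + b"]])
      fix y assume u: "\<forall>z. z \<in> A \<inter> (\<lambda>\<beta>. \<beta> * c + (a + b)) ` S \<longrightarrow> z = y"
      have "a = y"
        using both(1) by (rule u[rule_format])
      moreover have "a' = y"
        using both(2) by (rule u[rule_format])
      ultimately show "a = a'"
        by simp
    qed
  qed
qed

lemma affine_power_group_nontrivial: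
  "affine_power_group m \<noteq> {\<one>\<^bsub>BijGroup (UNIV :: 'a::{finite,field} set)\<^esub>}"
proof
  have "(\<lambda>\<beta>::'a. \<beta> * 1 + 1) \<in> affine_power_group m"
    unfolding affine_power_group_eq using power_subgroup_one by blast
  moreover assume "affine_power_group m = {\<one>\<^bsub>BijGroup (UNIV :: 'a::{finite,field} set)\<^esub>}"
  ultimately have "(\<lambda>\<beta>::'a. \<beta> * 1 + 1) = (\<lambda>\<beta>. \<beta>)"
    by (simp add: one_BijGroup_UNIV)
  from fun_cong[OF this, of 0] show False
    by simp
qed

lemma nontrivial_regular_direct_sum:
  assumes "non_synchronizing (UNIV :: 'a::{finite,field} set) (affine_power_group m)"
  obtains A S and a a' s s' :: "'a::{finite,field}"
  where "\<forall>c\<in>power_subgroup m. direct_sum A ((\<lambda>s. - (s * c)) ` S)"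
    and "a \<in> A" "a' \<in> A" "a \<noteq> a'" "s \<in> S" "s' \<in> S" "s \<noteq> s'"
proof -
  obtain P where "regular_partition (UNIV :: 'a set) (affine_power_group m) P" and
    nontriv: "\<not> trivial_partition UNIV P"
    using assms affine_power_group_nontrivial unfolding synchronizing_def by blast
  then obtain S where P: "partition_on UNIV P" and S: "is_section UNIV P S"
    and reg: "\<forall>g\<in>affine_power_group m. is_section UNIV P (g ` S)"
    unfolding regular_partition_def by blast
  obtain A a a' s s' where "A \<in> P" "a \<in> A" "a' \<in> A" "a \<noteq> a'" "s \<in> S" "s' \<in> S" "s \<noteq> s'"
    by (rule nontrivial_regular_partition[OF P S nontriv UNIV_not_empty])
  then show ?thesis
    using that[of A S a a' s s'] regular_partition_direct_sum[OF reg] by blast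
qed

lemma synchronizing_of_coprime:
  assumes p: "prime p" and card: "CARD('a::{finite,field}) = p ^ n" and m: "coprime m (\<Sum>i<n. p ^ i)"
  shows "synchronizing (UNIV :: 'a set) (affine_power_group m)"
proof (rule ccontr)
  assume "non_synchronizing (UNIV :: 'a set) (affine_power_group m)"
  then obtain A S and a a' s s' :: 'a
    where sum: "\<forall>c\<in>power_subgroup m. direct_sum A ((\<lambda>s. - (s * c)) ` S)"
      and mem: "a \<in> A" "a' \<in> A" "a \<noteq> a'" "s \<in> S" "s' \<in> S" "s \<noteq> s'"
    by (rule nontrivial_regular_direct_sum)
  \<comment> \<open>The quotient of the two differences is split so that both factors can be
    absorbed: \<open>k\<close> into \<open>A\<close>, being prime to \<open>p\<close>, and
    \<open>inverse d\<close> into \<open>S\<close>, being an \<open>m\<close>-th power. In the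
    resulting factorisation the two pairs represent the same element.\<close>
  obtain k d where k: "0 < k" "k < p" and d: "d \<in> power_subgroup m"
    and eq: "(s - s') / (a - a') = of_nat k * d"
    using prime_field_times_power[OF p card m, of "(s - s') / (a - a')"] mem by auto
  have d0: "d \<noteq> 0"
    using d by (rule power_subgroup_nonzero)
  have "coprime k (CARD('a))"
    unfolding card using k p by (metis coprime_commute coprime_power_right_iff nat_dvd_not_less prime_imp_coprime)
  then have ds: "direct_sum ((*) (of_nat k) ` A) ((\<lambda>s. - (s * inverse d)) ` S)"
    using k(1) bspec[OF sum power_subgroup_inverse[OF d]] by (intro direct_sum_multiple)
  have "of_nat k * (a - a') = (s - s') * inverse d"
    using eq mem d0 by (simp add: field_simps)
  then have "of_nat k * a + - (s * inverse d) = of_nat k * a' + - (s' * inverse d)"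
    by (simp add: algebra_simps)
  then have "- (s * inverse d) = - (s' * inverse d)"
    using direct_sum_unique[OF ds] mem by blast
  then show False
    using mem d0 by simp
qed

section \<open>Cliques and colourings of generalized Paley graphs\<close>

text \<open>An unordered pair may be matched in either order; the divisibility assumption closes the
  set of \<open>m\<close>-th powers under negation.\<close>

lemma paley_edge_iff:
  fixes x y :: "'a::{finite,field}"
  assumes "2 * m dvd CARD('a) - 1"
  shows "{x, y} \<in> paley_edges m \<longleftrightarrow> x - y \<in> power_subgroup m"
proof
  assume "{x, y} \<in> paley_edges m"
  then obtain a b where "{x, y} = {a, b}" "a - b \<in> power_subgroup m"
    by (auto simp: paley_edges_def)
  then show "x - y \<in> power_subgroup m"
    using uminus_mem_power_subgroup[OF assms, of "a - b"] by (auto simp: doubleton_eq_iff)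
qed (auto simp: paley_edges_def)

lemma max_clique_exists:
  assumes "finite V"
  obtains C where "C \<subseteq> V" "clique C E" "card C = clique_number V E"
proof -
  have "finite {card C |C. C \<subseteq> V \<and> clique C E}"
    using assms by simp
  moreover have "card {} \<in> {card C |C. C \<subseteq> V \<and> clique C E}"
    by (intro CollectI exI[of _ "{}"]) simp
  ultimately have "clique_number V E \<in> {card C |C. C \<subseteq> V \<and> clique C E}"
    unfolding clique_number_def by (intro Max_in) auto
  then show ?thesis
    using that by auto
qed

lemma card_le_clique_number:
  assumes "finite V" "C \<subseteq> V" "clique C E"
  shows "card C \<le> clique_number V E"
  unfolding clique_number_def using assms by (intro Max_ge) auto

lemma proper_colouring_chromatic_number:
  assumes "finite V" and "\<And>v. v \<in> V \<Longrightarrow> {v} \<notin> E"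
  obtains c where "proper_colouring V E (chromatic_number V E) c"
proof -
  obtain h where "bij_betw h V {0..<card V}"
    using ex_bij_betw_finite_nat[OF assms(1)] by blast
  then have "proper_colouring V E (card V) h"
    using assms(2) unfolding proper_colouring_def bij_betw_def inj_on_def by (force simp: atLeast0LessThan)
  then have "\<exists>c. proper_colouring V E (chromatic_number V E) c"
    unfolding chromatic_number_def by (intro LeastI_ex[of "\<lambda>k. \<exists>c. proper_colouring V E k c"]) blast
  then show ?thesis
    using that by blast
qed

lemma chromatic_number_le: "proper_colouring V E k c \<Longrightarrow> chromatic_number V E \<le> k"
  unfolding chromatic_number_def by (intro Least_le) blast

lemma proper_colouring_inj_on_clique:
  assumes "proper_colouring V E k c" "C \<subseteq> V" "clique C E"
  shows "inj_on c C"
  using assms unfolding proper_colouring_def clique_def inj_on_def by (meson subsetD)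

lemma card_clique_le_colours:
  assumes "proper_colouring V E k c" "C \<subseteq> V" "clique C E"
  shows "card C \<le> k"
  using card_inj_on_le[OF proper_colouring_inj_on_clique[OF assms], of "{..<k}"] assms
  unfolding proper_colouring_def by auto

text \<open>With as many colours as a maximum clique has vertices, each such clique meets every
  colour class exactly once. The group maps cliques to cliques, as it multiplies differences by
  \<open>m\<close>-th powers, which are \<open>k\<close>-th powers; so the colour classes form a
  regular partition.\<close>

lemma non_synchronizing_if_clique_eq_chromatic:
  assumes k: "2 * k dvd CARD('a::{finite,field}) - 1" "k dvd m" "k \<noteq> 1"
    and eq: "clique_number (UNIV :: 'a set) (paley_edges k) = chromatic_number (UNIV :: 'a set) (paley_edges k)"
  shows "non_synchronizing (UNIV :: 'a set) (affine_power_group m)"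
proof -
  let ?E = "paley_edges k :: 'a set set"
  let ?k = "chromatic_number (UNIV :: 'a set) ?E"
  note edge = paley_edge_iff[OF k(1)]
  have no_loop: "{v} \<notin> ?E" for v
    using edge[of v v] power_subgroup_nonzero[of "0::'a" k] by auto
  obtain c where c: "proper_colouring UNIV ?E ?k c"
    using proper_colouring_chromatic_number[of UNIV ?E] no_loop by auto
  obtain C where C: "clique C ?E" "card C = ?k"
    using max_clique_exists[of UNIV ?E] eq by auto
  have image_C: "c ` D = {..<?k} \<and> inj_on c D" if D: "clique D ?E" "card D = ?k" for D
  proof
    show inj: "inj_on c D"
      using proper_colouring_inj_on_clique[OF c _ D(1)] by simp
    have "c ` D \<subseteq> {..<?k}"
      using c unfolding proper_colouring_def by blast
    then show "c ` D = {..<?k}"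
      using D(2) card_image[OF inj] by (intro card_subset_eq) auto
  qed
  define P where "P = (\<lambda>i. c -` {i}) ` {..<?k}"
  have sec: "is_section UNIV P D" if D: "clique D ?E" "card D = ?k" for D
    unfolding is_section_def
  proof (intro conjI ballI)
    fix A assume "A \<in> P"
    then obtain i where i: "i < ?k" "A = c -` {i}"
      by (auto simp: P_def)
    then obtain x where "x \<in> D" "c x = i"
      using image_C[OF D] by (metis imageE lessThan_iff)
    then show "\<exists>!x. x \<in> A \<inter> D"
      using image_C[OF D] i by (intro ex1I[of _ x]) (auto dest: inj_onD)
  qed simp
  have "partition_on UNIV P"
  proof (rule partition_onI)
    have "c x < ?k" for x
      using c unfolding proper_colouring_def by blast
    then show "\<Union>P = UNIV"
      by (auto simp: P_def)
    show "{} \<notin> P"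
      using sec[OF C] by (auto simp: is_section_def)
  qed (auto simp: P_def disjnt_def)
  moreover have "is_section UNIV P (g ` C)" if g: "g \<in> affine_power_group m" for g
  proof (rule sec)
    obtain b x where b: "g = (\<lambda>\<beta>. \<beta> * b + x)" "b \<in> power_subgroup m"
      using g unfolding affine_power_group_eq by blast
    then have b': "b \<in> power_subgroup k" "b \<noteq> 0"
      using power_subgroup_mono[OF k(2)] power_subgroup_nonzero by blast+
    show "clique (g ` C) ?E"
      unfolding clique_def
    proof clarify
      fix y z assume yz: "y \<in> C" "z \<in> C" "g y \<noteq> g z"
      then have "y - z \<in> power_subgroup k"
        using C(1) unfolding clique_def by (metis edge)
      then have "(y - z) * b \<in> power_subgroup k"
        using b'(1) by (rule power_subgroup_mult)
      then show "{g y, g z} \<in> ?E"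
        by (simp add: edge b(1) algebra_simps)
    qed
    have "inj_on g C"
      using b'(2) by (auto simp: inj_on_def b(1))
    then show "card (g ` C) = ?k"
      by (simp add: card_image C(2))
  qed
  ultimately have "regular_partition UNIV (affine_power_group m) P"
    unfolding regular_partition_def using sec[OF C] by blast
  \<comment> \<open>A single class would contain the adjacent elements 0 and 1. If all classes were
    singletons, the section \<open>C\<close> would be the whole field and all nonzero elements would
    be \<open>k\<close>-th powers, against \<open>k \<noteq> 1\<close>.\<close>
  moreover have "\<not> trivial_partition UNIV P"
  proof
    assume "trivial_partition UNIV P"
    then consider "P = {UNIV}" | "P = {{\<omega>} |\<omega>. \<omega> \<in> UNIV}"
      by (auto simp: trivial_partition_def)
    then show False
    proof cases
      case 1
      moreover have "c 0 < ?k"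
        using c unfolding proper_colouring_def by blast
      ultimately have "c -` {c 0} = UNIV"
        unfolding P_def by blast
      then have "c 1 = c 0"
        by blast
      moreover have "{1, 0} \<in> ?E"
        by (simp add: edge power_subgroup_one)
      ultimately show False
        using c unfolding proper_colouring_def by blast
    next
      case 2
      obtain b :: 'a where b: "b \<noteq> 0" "b \<notin> power_subgroup k"
        using obtain_not_power[of k] k dvd_mult_right by blast
      have "UNIV \<subseteq> C"
      proof
        fix x
        have "{x} \<in> P"
          using 2 by blast
        then show "x \<in> C"
          using sec[OF C] unfolding is_section_def by blast
      qed
      then have "{b, 0} \<in> ?E"
        using C(1) b(1) unfolding clique_def by blast
      then show False
        using b(2) by (simp add: edge)
    qed
  qed
  ultimately show ?thesis
    unfolding synchronizing_def by blast
qed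

section \<open>From factorisations back to cliques and colourings\<close>

text \<open>\<open>X\<close> is a clique, and colouring by the \<open>X\<close>-component gives
  classes that are translates of \<open>Y\<close>, hence without edges. So the chromatic number is
  at most \<open>card X\<close>, which is at most the clique number.\<close>

lemma clique_eq_chromatic_if_direct_sum:
  assumes m: "2 * m dvd CARD('a::{finite,field}) - 1" and XY: "direct_sum X (Y :: 'a set)"
    and X: "\<And>x x'. x \<in> X \<Longrightarrow> x' \<in> X \<Longrightarrow> x \<noteq> x' \<Longrightarrow> x - x' \<in> power_subgroup m"
    and Y: "\<And>y y'. y \<in> Y \<Longrightarrow> y' \<in> Y \<Longrightarrow> y - y' \<notin> power_subgroup m"
  shows "clique_number (UNIV :: 'a set) (paley_edges m) = chromatic_number (UNIV :: 'a set) (paley_edges m)"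
proof (rule antisym)
  let ?E = "paley_edges m :: 'a set set"
  note edge = paley_edge_iff[OF m]
  have "clique X ?E"
    unfolding clique_def using X by (simp add: edge)
  then have "card X \<le> clique_number UNIV ?E"
    by (intro card_le_clique_number) auto
  obtain h where h: "bij_betw h X {0..<card X}"
    using ex_bij_betw_finite_nat[of X] by auto
  have "\<exists>x\<in>X. z - x \<in> Y" for z
    using direct_sum_obtain[OF XY, of z] by (metis add_diff_cancel_left')
  then obtain f where f: "\<And>z. f z \<in> X" "\<And>z. z - f z \<in> Y"
    by metis
  have "proper_colouring UNIV ?E (card X) (h \<circ> f)"
    unfolding proper_colouring_def
  proof (intro conjI ballI impI notI)
    show "(h \<circ> f) ` UNIV \<subseteq> {..<card X}"
      using bij_betw_imp_surj_on[OF h] f(1) by fastforce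
    fix u v assume uv: "{u, v} \<in> ?E" and "(h \<circ> f) u = (h \<circ> f) v"
    then have "f u = f v"
      using inj_onD[OF bij_betw_imp_inj_on[OF h]] f(1) by simp
    then have "u - v = (u - f u) - (v - f v)"
      by simp
    then show False
      using Y[OF f(2) f(2)] uv by (metis edge)
  qed
  then have "chromatic_number UNIV ?E \<le> card X"
    by (rule chromatic_number_le)
  with \<open>card X \<le> _\<close> show "chromatic_number UNIV ?E \<le> clique_number UNIV ?E"
    by linarith
  obtain C where C: "clique C ?E" "card C = clique_number UNIV ?E"
    using max_clique_exists[of UNIV ?E] by auto
  have "{v} \<notin> ?E" for v
    using edge[of v v] power_subgroup_nonzero[of "0::'a" m] by auto
  then obtain c where "proper_colouring UNIV ?E (chromatic_number UNIV ?E) c"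
    using proper_colouring_chromatic_number[of UNIV ?E] by auto
  then show "clique_number UNIV ?E \<le> chromatic_number UNIV ?E"
    using card_clique_le_colours C by (metis subset_UNIV)
qed

lemma direct_sum_divide:
  fixes c :: "'a::field"
  assumes "direct_sum X Y" "c \<noteq> 0"
  shows "direct_sum ((\<lambda>x. x / c) ` X) ((\<lambda>x. x / c) ` Y)"
proof (rule direct_sumI)
  fix z
  obtain x y where "x \<in> X" "y \<in> Y" "z * c = x + y"
    by (rule direct_sum_obtain[OF assms(1)])
  moreover from this have "z = x / c + y / c"
    using assms(2) by (simp add: field_simps)
  ultimately show "\<exists>a\<in>(\<lambda>x. x / c) ` X. \<exists>b\<in>(\<lambda>x. x / c) ` Y. z = a + b"
    by blast
next
  fix a a' b b'
  assume "a \<in> (\<lambda>x. x / c) ` X" "a' \<in> (\<lambda>x. x / c) ` X" "b \<in> (\<lambda>x. x / c) ` Y" "b' \<in> (\<lambda>x. x / c) ` Y"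
    and eq: "a + b = a' + b'"
  then obtain x x' y y' where xy: "x \<in> X" "x' \<in> X" "y \<in> Y" "y' \<in> Y"
    and ab: "a = x / c" "a' = x' / c" "b = y / c" "b' = y' / c"
    by (elim imageE)
  have "x + y = x' + y'"
    using eq assms(2) by (simp add: ab field_simps)
  then show "a = a'"
    using direct_sum_unique[OF assms(1) xy] by (simp add: ab)
qed

text \<open>Division by \<open>c\<close> turns the coset of \<open>c\<close> into the subgroup of
  \<open>m\<close>-th powers and preserves factorisations.\<close>

lemma clique_eq_chromatic_if_one_coset:
  assumes m: "2 * m dvd CARD('a::{finite,field}) - 1" and XY: "direct_sum X (Y :: 'a set)"
    and c: "c \<noteq> 0"
    and X: "\<And>x x'. x \<in> X \<Longrightarrow> x' \<in> X \<Longrightarrow> x \<noteq> x' \<Longrightarrow> (x - x') / c \<in> power_subgroup m"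
    and Y: "\<And>y y'. y \<in> Y \<Longrightarrow> y' \<in> Y \<Longrightarrow> (y - y') / c \<notin> power_subgroup m"
  shows "clique_number (UNIV :: 'a set) (paley_edges m) = chromatic_number (UNIV :: 'a set) (paley_edges m)"
proof (rule clique_eq_chromatic_if_direct_sum[OF m direct_sum_divide[OF XY c]])
  fix x x' assume "x \<in> (\<lambda>x. x / c) ` X" "x' \<in> (\<lambda>x. x / c) ` X" "x \<noteq> x'"
  then show "x - x' \<in> power_subgroup m"
    using X by (auto simp flip: diff_divide_distrib)
next
  fix y y' assume "y \<in> (\<lambda>x. x / c) ` Y" "y' \<in> (\<lambda>x. x / c) ` Y"
  then show "y - y' \<notin> power_subgroup m"
    using Y by (auto simp flip: diff_divide_distrib)
qed

text \<open>In the factorisation \<open>A \<oplus> B\<close> coming from a regular partition, the differences within \<open>A\<close>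
  and those within \<open>B\<close> occupy disjoint sets of cosets of the subgroup of \<open>m\<close>-th powers. As there
  are at most three cosets, one of the two sets of differences lies in a single coset.\<close>
lemma clique_eq_chromatic_if_non_synchronizing:
  assumes m: "2 * m dvd CARD('a::{finite,field}) - 1" "m \<le> 3"
    and nonsync: "non_synchronizing (UNIV :: 'a set) (affine_power_group m)"
  shows "clique_number (UNIV :: 'a set) (paley_edges m) = chromatic_number (UNIV :: 'a set) (paley_edges m)"
proof -
  have mq: "m dvd CARD('a) - 1"
    using m(1) dvd_mult_right by blast
  then have "m > 0"
    using CARD_field_gt_1[where ?'a = 'a] by (auto intro!: gr0I)
  \<comment> \<open>On nonzero elements the fibres of \<open>\<phi>\<close> are the cosets of the
    \<open>m\<close>-th powers, and its values are \<open>m\<close>-th roots of unity; cosets are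
    counted through these values.\<close>
  define \<phi> where "\<phi> x = x ^ ((CARD('a) - 1) div m)" for x :: 'a
  have \<phi>_root: "\<phi> x ^ m = 1" if "x \<noteq> 0" for x
    using mq that by (simp add: \<phi>_def field_power_card_minus_1 del: One_nat_def flip: power_mult)
  have \<phi>_eq_iff: "x / y \<in> power_subgroup m \<longleftrightarrow> \<phi> x = \<phi> y" if "y \<noteq> 0" for x y
    using that unfolding power_subgroup_eq_roots(1)[OF mq] \<phi>_def by (simp add: power_divide)
  obtain A S and a a' s s' :: 'a
    where sum: "\<forall>c\<in>power_subgroup m. direct_sum A ((\<lambda>s. - (s * c)) ` S)"
      and mem: "a \<in> A" "a' \<in> A" "a \<noteq> a'" "s \<in> S" "s' \<in> S" "s \<noteq> s'"
    using nonsync by (rule nontrivial_regular_direct_sum)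
  define B where "B = (\<lambda>s. - (s * 1)) ` S"
  have AB: "direct_sum A B"
    unfolding B_def using sum power_subgroup_one by blast
  \<comment> \<open>Equal values make the quotient \<open>?c\<close> of the differences an
    \<open>m\<close>-th power; then \<open>x + y' * ?c = x' + y * ?c\<close> gives two
    representations in the factorisation belonging to \<open>?c\<close>.\<close>
  have distinct: "\<phi> (x - x') \<noteq> \<phi> (y - y')"
    if xy: "x \<in> A" "x' \<in> A" "x \<noteq> x'" "y \<in> B" "y' \<in> B" "y \<noteq> y'" for x x' y y'
  proof
    assume "\<phi> (x - x') = \<phi> (y - y')"
    then have c: "(x - x') / (y - y') \<in> power_subgroup m" (is "?c \<in> _")
      using \<phi>_eq_iff xy(6) by simp
    have shift: "x + y' * e = x' + y * e" if "(y - y') * e = x - x'" for e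
      using that by (simp add: algebra_simps)
    have "direct_sum A ((\<lambda>s. - (s * ?c)) ` S)"
      using sum c by blast
    moreover have "y * ?c \<in> (\<lambda>s. - (s * ?c)) ` S" "y' * ?c \<in> (\<lambda>s. - (s * ?c)) ` S"
      using xy(4,5) unfolding B_def by (auto simp: image_iff)
    moreover have "x + y' * ?c = x' + y * ?c"
      by (rule shift) (use xy(6) in simp)
    ultimately have "x = x'"
      using direct_sum_unique xy(1,2) by blast
    then show False
      using xy(3) by simp
  qed
  define \<Phi> where "\<Phi> X = {\<phi> (x - x') |x x'. x \<in> X \<and> x' \<in> X \<and> x \<noteq> x'}" for X
  have "\<Phi> A \<inter> \<Phi> B = {}"
    unfolding \<Phi>_def using distinct by fastforce
  have "card (\<Phi> A \<union> \<Phi> B) \<le> card {z::'a. z ^ m = 1}"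
    unfolding \<Phi>_def by (intro card_mono) (auto simp: \<phi>_root)
  also have "\<dots> \<le> m"
    using \<open>m > 0\<close> by (rule card_roots_of_unity_le)
  finally have "card (\<Phi> A) + card (\<Phi> B) \<le> 3"
    using m(2) \<open>\<Phi> A \<inter> \<Phi> B = {}\<close> by (simp add: card_Un_disjoint)
  then have "card (\<Phi> A) \<le> 1 \<or> card (\<Phi> B) \<le> 1"
    by linarith
  \<comment> \<open>Here \<open>X\<close> and \<open>Y\<close> are arbitrary because either of
    \<open>A\<close> and \<open>B\<close> may be the summand whose differences lie in one coset;
    divided by \<open>a - b\<close>, that summand is the clique.\<close>
  moreover have ?thesis
    if XY: "direct_sum X Y" and card: "card (\<Phi> X) \<le> 1" and ab: "a \<in> X" "b \<in> X" "a \<noteq> b"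
      and disj: "\<Phi> X \<inter> \<Phi> Y = {}" for X Y a b
  proof (rule clique_eq_chromatic_if_one_coset[OF m(1) XY])
    have \<Phi>I: "\<phi> (x - x') \<in> \<Phi> Z" if "x \<in> Z" "x' \<in> Z" "x \<noteq> x'" for x x' Z
      unfolding \<Phi>_def using that by blast
    show "a - b \<noteq> 0"
      using ab(3) by simp
    then have iff: "z / (a - b) \<in> power_subgroup m \<longleftrightarrow> \<phi> z = \<phi> (a - b)" for z
      by (rule \<phi>_eq_iff)
    show "(x - x') / (a - b) \<in> power_subgroup m" if "x \<in> X" "x' \<in> X" "x \<noteq> x'" for x x'
      unfolding iff using card \<Phi>I[OF that] \<Phi>I[OF ab] card_le_Suc0_iff_eq[of "\<Phi> X"] by simp
    show "(y - y') / (a - b) \<notin> power_subgroup m" if "y \<in> Y" "y' \<in> Y" for y y'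
    proof (cases "y = y'")
      case True
      then show ?thesis
        using power_subgroup_nonzero by fastforce
    next
      case False
      then show ?thesis
        unfolding iff using \<Phi>I[OF that False] \<Phi>I[OF ab] disj by auto
    qed
  qed
  moreover have "- s \<in> B" "- s' \<in> B" "- s \<noteq> - s'"
    using mem(4-6) by (auto simp: B_def)
  ultimately show ?thesis
    using AB direct_sum_commute[OF AB] mem(1-3) \<open>\<Phi> A \<inter> \<Phi> B = {}\<close> by (metis Int_commute)
qed

section \<open>Partitions into cosets of a multiple of a subfield\<close>

text \<open>In the plane that the field forms over its subfield \<open>K\<close> of order
  \<open>p ^ h\<close>, the group maps \<open>K\<close> to translates of lines \<open>e K\<close>
  with \<open>e\<close> an \<open>m\<close>-th power. None of these lines is \<open>c K\<close>,
  since \<open>e\<close> and the nonzero elements of \<open>K\<close> are \<open>d\<close>-th powers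
  and \<open>c\<close> is not; and non-parallel lines meet in one point.\<close>

lemma non_synchronizing_of_subfield:
  assumes p: "prime p" and card: "CARD('a::{finite,field}) = (p ^ h)\<^sup>2"
    and d: "d dvd m" "d dvd p ^ h + 1" "d \<noteq> 1"
  shows "non_synchronizing (UNIV :: 'a set) (affine_power_group m)"
proof -
  define s where "s = p ^ h"
  have card': "CARD('a) = s ^ 2"
    by (simp add: card s_def)
  have "s > 1"
    using CARD_field_gt_1[where ?'a = 'a] unfolding card' by (metis less_one nat_neq_iff one_power2 power_zero_numeral not_less_iff_gr_or_eq)
  have q: "CARD('a) - 1 = (s + 1) * (s - 1)"
    unfolding card' by (simp add: power2_eq_square algebra_simps)
  have dq: "d dvd CARD('a) - 1"
    unfolding q using d(2) unfolding s_def by (rule dvd_mult2)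
  have "CHAR('a) = p"
    using p card by (intro CHAR_eq_of_CARD_prime_power[of p "h * 2"]) (simp_all add: power_mult)
  define K where "K = {x::'a. x ^ s = x}"
  have K_add: "x + y \<in> K" if "x \<in> K" "y \<in> K" for x y
    using that p freshmans_dream'[of s h x y] \<open>CHAR('a) = p\<close> by (simp add: K_def s_def)
  have K_diff: "x - y \<in> K" if "x \<in> K" "y \<in> K" for x y
    using that p freshmans_dream'[of s h "x - y" y] \<open>CHAR('a) = p\<close> by (simp add: K_def s_def eq_diff_eq)
  have K_divide: "x / y \<in> K" if "x \<in> K" "y \<in> K" for x y
    using that by (simp add: K_def power_divide)
  have zero_one: "0 \<in> K" "1 \<in> K"
    using \<open>s > 1\<close> by (simp_all add: K_def)
  \<comment> \<open>As \<open>q - 1 = (s + 1) * (s - 1)\<close>, the roots of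
    \<open>x ^ (s - 1) = 1\<close> are the \<open>(s + 1)\<close>-th powers. This yields the size of
    \<open>K\<close> and, since \<open>d\<close> divides \<open>s + 1\<close>, the fact
    \<open>K_power\<close>.\<close>
  have K_eq: "K = insert 0 (power_subgroup (s + 1))"
  proof -
    have "(CARD('a) - 1) div (s + 1) = s - 1"
      unfolding q by (rule nonzero_mult_div_cancel_left) simp
    then have "(power_subgroup (s + 1) :: 'a set) = {x. x ^ (s - 1) = 1}"
      using q power_subgroup_eq_roots(1)[of "s + 1", where ?'a = 'a] by (metis dvd_triv_left)
    moreover have "x ^ s = x * x ^ (s - 1)" for x :: 'a
      using \<open>s > 1\<close> by (metis One_nat_def Suc_pred less_trans power_Suc zero_less_one)
    ultimately show ?thesis
      using \<open>s > 1\<close> by (auto simp: K_def)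
  qed
  have "card (power_subgroup (s + 1) :: 'a set) = s - 1"
    using q power_subgroup_eq_roots(2)[of "s + 1", where ?'a = 'a] by (metis dvd_triv_left nonzero_mult_div_cancel_left add_is_0 one_neq_zero)
  then have card_K: "card K = s"
    using \<open>s > 1\<close> power_subgroup_nonzero by (subst K_eq, subst card_insert_disjoint) auto
  have K_power: "x \<in> power_subgroup d" if "x \<in> K" "x \<noteq> 0" for x
    using that K_eq power_subgroup_mono[of d "s + 1", where ?'a = 'a] d(2) by (auto simp: s_def)
  obtain c :: 'a where c: "c \<noteq> 0" "c \<notin> power_subgroup d"
    using obtain_not_power[OF dq d(3)] by blast
  have sum: "direct_sum ((*) c ` K) ((\<lambda>\<beta>. \<beta> * e) ` K)" if e: "e \<in> power_subgroup m" for e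
    unfolding direct_sum_def
  proof -
    have e': "e \<in> power_subgroup d" "e \<noteq> 0"
      using e power_subgroup_mono[OF d(1)] power_subgroup_nonzero by blast+
    have inj: "inj_on (\<lambda>(a, b). a + b) ((*) c ` K \<times> (\<lambda>\<beta>. \<beta> * e) ` K)"
    proof (rule inj_onI, clarify)
      fix k k' l l' assume K: "k \<in> K" "k' \<in> K" "l \<in> K" "l' \<in> K"
        and eq: "c * k + k' * e = c * l + l' * e"
      then have eq': "c * (k - l) = (l' - k') * e"
        by (simp add: algebra_simps)
      have "k = l"
      proof (rule ccontr)
        assume "k \<noteq> l"
        then have "c = (l' - k') / (k - l) * e"
          using eq' by (simp add: field_simps)
        moreover from this have "(l' - k') / (k - l) \<noteq> 0"
          using c(1) by auto
        then have "(l' - k') / (k - l) \<in> power_subgroup d"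
          using K by (intro K_power K_divide K_diff)
        ultimately show False
          using c(2) e'(1) power_subgroup_mult by metis
      qed
      then show "c * k = c * l \<and> k' * e = l' * e"
        using eq by simp
    qed
    have "card ((\<lambda>(a, b). a + b) ` ((*) c ` K \<times> (\<lambda>\<beta>. \<beta> * e) ` K)) = CARD('a)"
      using c(1) e'(2) by (simp add: card_image[OF inj] card_cartesian_product card_image inj_on_def card_K card' power2_eq_square)
    then have "(\<lambda>(a, b). a + b) ` ((*) c ` K \<times> (\<lambda>\<beta>. \<beta> * e) ` K) = UNIV"
      by (intro card_subset_eq) auto
    then show "bij_betw (\<lambda>(a, b). a + b) ((*) c ` K \<times> (\<lambda>\<beta>. \<beta> * e) ` K) UNIV"
      using inj by (simp add: bij_betw_def)
  qed
  \<comment> \<open>This is \<open>a + c K\<close>, written so that membership becomes a condition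
    on \<open>K\<close>.\<close>
  define coset where "coset a = {x. (x - a) / c \<in> K}" for a
  define P where "P = range coset"
  have coset_eq: "coset a = coset b" if "x \<in> coset a" "x \<in> coset b" for a b x
  proof -
    have ab: "(a - b) / c \<in> K"
      using K_diff[of "(x - b) / c" "(x - a) / c"] that by (simp add: coset_def diff_divide_distrib)
    show ?thesis
    proof (rule Set.set_eqI)
      fix y
      show "y \<in> coset a \<longleftrightarrow> y \<in> coset b"
        using K_add[OF _ ab, of "(y - a) / c"] K_diff[OF _ ab, of "(y - b) / c"]
        by (auto simp: coset_def diff_divide_distrib)
    qed
  qed
  have mem_coset: "a \<in> coset a" for a
    by (simp add: coset_def zero_one)
  have sec: "is_section UNIV P (g ` K)" if g: "g \<in> affine_power_group m" for g
    unfolding is_section_def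
  proof (intro conjI ballI)
    fix A assume "A \<in> P"
    then obtain a where a: "A = coset a"
      by (auto simp: P_def)
    obtain e x where ex: "g = (\<lambda>\<beta>. \<beta> * e + x)" "e \<in> power_subgroup m"
      using g unfolding affine_power_group_eq by blast
    show "\<exists>!y. y \<in> A \<inter> g ` K"
    proof (rule ex_ex1I)
      obtain k l where "k \<in> K" "l \<in> K" "a - x = c * k + l * e"
        using direct_sum_obtain[OF sum[OF ex(2)], of "a - x"] by blast
      then have "g l = l * e + x" "(g l - a) / c = 0 - k"
        using c(1) by (simp_all add: ex(1) field_simps)
      then have "g l \<in> A"
        using K_diff[OF zero_one(1) \<open>k \<in> K\<close>] by (simp add: a coset_def)
      then show "\<exists>y. y \<in> A \<inter> g ` K"
        using \<open>l \<in> K\<close> by blast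
    next
      fix y z assume "y \<in> A \<inter> g ` K" "z \<in> A \<inter> g ` K"
      then obtain k l where kl: "k \<in> K" "l \<in> K" "y = k * e + x" "z = l * e + x"
        and yz: "(y - a) / c \<in> K" "(z - a) / c \<in> K"
        by (auto simp: a coset_def ex(1))
      have "c * ((y - a) / c) + l * e = c * ((z - a) / c) + k * e"
        using c(1) by (simp add: kl(3,4))
      then have "c * ((y - a) / c) = c * ((z - a) / c)"
        using direct_sum_unique[OF sum[OF ex(2)]] yz kl(1,2) by blast
      then show "y = z"
        using c(1) by simp
    qed
  qed simp
  have "(\<lambda>\<beta>::'a. \<beta> * 1 + 0) \<in> affine_power_group m"
    unfolding affine_power_group_eq using power_subgroup_one by blast
  from sec[OF this] have "is_section UNIV P K"
    by simp
  moreover have "partition_on UNIV P"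
  proof (rule partition_onI)
    show "\<Union>P = UNIV"
      using mem_coset by (auto simp: P_def)
    show "{} \<notin> P"
      using mem_coset by (auto simp: P_def)
    show "disjnt A B" if "A \<in> P" "B \<in> P" "A \<noteq> B" for A B
      using that coset_eq unfolding P_def disjnt_def by blast
  qed
  ultimately have "regular_partition UNIV (affine_power_group m) P"
    unfolding regular_partition_def using sec by blast
  \<comment> \<open>With one part only, the square of \<open>c\<close> would lie in
    \<open>c K\<close>, hence \<open>c\<close> in \<open>K\<close>, and \<open>c\<close> would be a
    \<open>d\<close>-th power. The part \<open>c K\<close> contains both 0 and \<open>c\<close>, so
    it is no singleton.\<close>
  moreover have "\<not> trivial_partition UNIV P"
  proof
    have "coset 0 \<in> P"
      by (simp add: P_def)
    assume "trivial_partition UNIV P"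
    then consider "P = {UNIV}" | "P = {{\<omega>} |\<omega>. \<omega> \<in> UNIV}"
      by (auto simp: trivial_partition_def)
    then show False
    proof cases
      case 1
      then have "c\<^sup>2 \<in> coset 0"
        using \<open>coset 0 \<in> P\<close> by blast
      then have "c \<in> K"
        using c(1) by (simp add: coset_def power2_eq_square)
      then show False
        using K_power c by blast
    next
      case 2
      then obtain w where "coset 0 = {w}"
        using \<open>coset 0 \<in> P\<close> by blast
      moreover have "0 \<in> coset 0" "c \<in> coset 0"
        using c(1) by (simp_all add: coset_def zero_one)
      ultimately show False
        using c(1) by (metis singletonD)
    qed
  qed
  ultimately show ?thesis
    unfolding synchronizing_def by blast
qed

section \<open>The six claims, from the criteria for (non-)synchronization\<close>

text \<open>The condition \<open>mbar \<noteq> 1\<close> leaves out the complete graph, whose clique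
  and chromatic numbers always agree; for \<open>m = 1\<close>, say, the group is nevertheless
  synchronizing by \<open>synchronizing_of_coprime\<close>.\<close>

theorem theorem5p2:
  fixes p n m q r mbar :: nat
  assumes "prime p" and "odd p" and "n \<ge> 1"
    and "q = p ^ n"
    and "card (UNIV :: 'a::{finite,field} set) = q"
    and "m > 0" and "m dvd q - 1"
    and "r = (q - 1) div m"
    and "mbar = (if even r then m else m div 2)"
  shows
    "(mbar \<noteq> 1 \<longrightarrow>
       clique_number (UNIV :: 'a set) (paley_edges mbar)
         = chromatic_number (UNIV :: 'a set) (paley_edges mbar) \<longrightarrow>
       non_synchronizing (UNIV :: 'a set) (affine_power_group m))
     \<and> (m \<in> {2, 3} \<longrightarrow> 2 * m dvd q - 1 \<longrightarrow>
       (non_synchronizing (UNIV :: 'a set) (affine_power_group m) \<longleftrightarrow>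
        clique_number (UNIV :: 'a set) (paley_edges m)
          = chromatic_number (UNIV :: 'a set) (paley_edges m)))
     \<and> (prime n \<longrightarrow> m \<in> {2, 3} \<longrightarrow> \<not> m dvd (\<Sum>i<n. p ^ i) \<longrightarrow>
       synchronizing (UNIV :: 'a set) (affine_power_group m))
     \<and> (even n \<longrightarrow> gcd m (p ^ (n div 2) + 1) \<noteq> 1 \<longrightarrow>
       non_synchronizing (UNIV :: 'a set) (affine_power_group m))
     \<and> (odd n \<longrightarrow> synchronizing (UNIV :: 'a set) (affine_power_group 2))
     \<and> (n = 2 \<longrightarrow>
       non_synchronizing (UNIV :: 'a set) (affine_power_group 2) \<and>
       (3 dvd p ^ 2 - 1 \<longrightarrow>
         (non_synchronizing (UNIV :: 'a set) (affine_power_group 3) \<longleftrightarrow> 3 dvd p + 1)))"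
proof -
  note p = assms(1) and card = assms(5)[unfolded assms(4)]
  have mq: "m dvd CARD('a) - 1"
    using assms(5,7) by simp
  have mr: "CARD('a) - 1 = m * r"
    using mq assms(5,8) by simp
  \<comment> \<open>For even \<open>r\<close>, \<open>2 * m\<close> divides
    \<open>m * r = q - 1\<close>. For odd \<open>r\<close>, \<open>m\<close> is even because
    \<open>q - 1\<close> is, so \<open>2 * mbar = m\<close>.\<close>
  have "2 * mbar dvd CARD('a) - 1 \<and> mbar dvd m"
  proof (cases "even r")
    case True
    then show ?thesis
      unfolding mr using assms(9) by (auto elim!: evenE)
  next
    case False
    have "even (CARD('a) - 1)"
      using card assms(2) by simp
    then have "even m"
      unfolding mr using False by simp
    then obtain j where "m = 2 * j"
      by (rule evenE)
    then show ?thesis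
      unfolding mr using assms(9) False by simp
  qed
  then have 1: "non_synchronizing (UNIV :: 'a set) (affine_power_group m)"
    if "mbar \<noteq> 1" "clique_number (UNIV :: 'a set) (paley_edges mbar)
         = chromatic_number (UNIV :: 'a set) (paley_edges mbar)"
    using that non_synchronizing_if_clique_eq_chromatic by blast
  have 2: "non_synchronizing (UNIV :: 'a set) (affine_power_group m) \<longleftrightarrow>
        clique_number (UNIV :: 'a set) (paley_edges m)
          = chromatic_number (UNIV :: 'a set) (paley_edges m)"
    if m: "m \<in> {2, 3}" "2 * m dvd q - 1"
  proof
    have "2 * m dvd CARD('a) - 1" "m \<le> 3" "m \<noteq> 1"
      using m assms(5) by auto
    then show "clique_number (UNIV :: 'a set) (paley_edges m) = chromatic_number (UNIV :: 'a set) (paley_edges m)"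
      if "non_synchronizing (UNIV :: 'a set) (affine_power_group m)"
      using that by (intro clique_eq_chromatic_if_non_synchronizing)
    show "non_synchronizing (UNIV :: 'a set) (affine_power_group m)"
      if "clique_number (UNIV :: 'a set) (paley_edges m) = chromatic_number (UNIV :: 'a set) (paley_edges m)"
      using \<open>2 * m dvd CARD('a) - 1\<close> dvd_refl \<open>m \<noteq> 1\<close> that by (rule non_synchronizing_if_clique_eq_chromatic)
  qed
  have sync: "synchronizing (UNIV :: 'a set) (affine_power_group k)"
    if "prime k" "\<not> k dvd (\<Sum>i<n. p ^ i)" for k
    using p card prime_imp_coprime[OF that] by (rule synchronizing_of_coprime)
  have 3: "synchronizing (UNIV :: 'a set) (affine_power_group m)"
    if "m \<in> {2, 3}" "\<not> m dvd (\<Sum>i<n. p ^ i)"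
    using that by (intro sync) auto
  have 4: "non_synchronizing (UNIV :: 'a set) (affine_power_group k)"
    if "even n" "gcd k (p ^ (n div 2) + 1) \<noteq> 1" for k
  proof (rule non_synchronizing_of_subfield[OF p, of "n div 2" "gcd k (p ^ (n div 2) + 1)"])
    show "CARD('a) = (p ^ (n div 2))\<^sup>2"
      using card that(1) by (simp flip: power_mult)
  qed (use that in auto)
  have 5: "synchronizing (UNIV :: 'a set) (affine_power_group 2)" if "odd n"
  proof (rule sync)
    have "odd (\<Sum>i<n. p ^ i) \<longleftrightarrow> odd n"
      using assms(2) by (induction n) auto
    then show "\<not> 2 dvd (\<Sum>i<n. p ^ i)"
      using that by simp
  qed simp
  have 6: "non_synchronizing (UNIV :: 'a set) (affine_power_group 2)"
    "non_synchronizing (UNIV :: 'a set) (affine_power_group 3) \<longleftrightarrow> 3 dvd p + 1" if n: "n = 2"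
  proof -
    have gcd: "gcd k (p ^ (n div 2) + 1) = k" if "k dvd p + 1" for k
      using that n by (simp add: gcd_proj1_iff)
    show "non_synchronizing (UNIV :: 'a set) (affine_power_group 2)"
      using 4[of 2] gcd[of 2] n assms(2) by simp
    \<comment> \<open>For \<open>n = 2\<close> this sum and \<open>p ^ (n div 2) + 1\<close>
      coincide, so for the prime 3 the criteria \<open>sync\<close> and \<open>4\<close> are
      complementary.\<close>
    have "(\<Sum>i<n. p ^ i) = p + 1"
      by (simp add: n numeral_2_eq_2)
    then show "non_synchronizing (UNIV :: 'a set) (affine_power_group 3) \<longleftrightarrow> 3 dvd p + 1"
      using sync[of 3] 4[of 3] gcd[of 3] n by auto
  qed
  show ?thesis
    using 1 2 3 4[of m] 5 6 by blast
qed

end
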